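(* Let $n\ge 1$ and consider the Markov arrival process (MAP) representing the level superposition of $n$ symmetric sub-trees whose individual MAPs are refined and identical, each with state set $\mathcal S$ of finite size $m_{\mathcal S}\ge 3$. Then the number $N_p$ of lumpable partitions (equivalence classes of states) within the superposed MAP is $$N_p=\binom{n+m_{\mathcal S}-1}{m_{\mathcal S}-1}\le m_{\mathcal S}^{\,n}.$$
   Context: The level superposition of $n$ MAPs is the MAP formed by the Kronecker sums of their transition matrices; when the $n$ MAPs are identical with state set $\mathcal S$, its state set is $\mathcal S^n$, whose elements are tuples $A=(A_1,\dots,A_n)$, $A_j\in\mathcal S$ being the state of sub-tree $j$. Symmetric sub-trees have identical MAPs. A MAP is called refined if no two distinct states of it are equivalent (i.e. all equivalent states inside a sub-tree have already been lumped). Consequently the equivalence on $\mathcal S^n$ is the one induced by permutations of the $n$ symmetric sub-trees: $A,B\in\mathcal S^n$ are equivalent iff there is a permutation $f$ of $\{1,\dots,n\}$ with $A_i=B_{f(i)}$ for all $i$. A lumpable partition is one equivalence class of this relation, and $N_p$ is the number of equivalence classes. *)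

theory Defs
  imports "HOL-Analysis.Analysis" "HOL-Combinatorics.Permutations"
begin

text \<open>
  A Markov arrival process with state set the finite type \<open>'s\<close>: \<open>D0\<close> holds the rates of
  transitions without an arrival (with the usual negative diagonal), \<open>D1\<close> those of
  transitions with an arrival.
\<close>

record ('s::finite) MAP =
  D0 :: "real ^ 's ^ 's"
  D1 :: "real ^ 's ^ 's"

definition is_MAP :: "('s::finite) MAP \<Rightarrow> bool" where
  "is_MAP M \<longleftrightarrow>
     (\<forall>a b. a \<noteq> b \<longrightarrow> 0 \<le> D0 M $ a $ b) \<and>
     (\<forall>a b. 0 \<le> D1 M $ a $ b) \<and>
     (\<forall>a. (\<Sum>b\<in>UNIV. (D0 M + D1 M) $ a $ b) = 0)"

text \<open>
  The Kronecker sum of the matrices \<open>X j\<close> is the sum over \<open>j\<close> of the Kronecker products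
  of \<open>X j\<close> in position \<open>j\<close> with identity matrices in all other positions. Rows and columns
  are indexed by tuples, so an entry of a Kronecker product is the product of the
  entries of the factors.
\<close>

definition kronecker_sum ::
    "('n::finite \<Rightarrow> real ^ 's ^ 's) \<Rightarrow> real ^ ('s::finite ^ 'n) ^ ('s ^ 'n)" where
  "kronecker_sum X =
     (\<chi> A B. \<Sum>j\<in>UNIV. \<Prod>k\<in>UNIV. (if k = j then X k else mat 1) $ (A $ k) $ (B $ k))"

definition superposition :: "('n::finite \<Rightarrow> ('s::finite) MAP) \<Rightarrow> ('s ^ 'n) MAP" where
  "superposition M =
     \<lparr> D0 = kronecker_sum (\<lambda>j. D0 (M j)), D1 = kronecker_sum (\<lambda>j. D1 (M j)) \<rparr>"

text \<open>
  Ordinary lumpability of a MAP: the aggregated rates into each class, with and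
  without an arrival, do not depend on the representative of the source class.
\<close>

definition lumping :: "('s::finite) MAP \<Rightarrow> 's rel \<Rightarrow> bool" where
  "lumping M r \<longleftrightarrow> equiv UNIV r \<and>
     (\<forall>(a, b)\<in>r. \<forall>C\<in>UNIV // r.
        (\<Sum>c\<in>C. D0 M $ a $ c) = (\<Sum>c\<in>C. D0 M $ b $ c) \<and>
        (\<Sum>c\<in>C. D1 M $ a $ c) = (\<Sum>c\<in>C. D1 M $ b $ c))"

definition equivalent_states :: "('s::finite) MAP \<Rightarrow> 's \<Rightarrow> 's \<Rightarrow> bool" where
  "equivalent_states M a b \<longleftrightarrow> (\<exists>r. lumping M r \<and> (a, b) \<in> r)"

definition refined :: "('s::finite) MAP \<Rightarrow> bool" where
  "refined M \<longleftrightarrow> (\<forall>a b. equivalent_states M a b \<longrightarrow> a = b)"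

text \<open>
  The equivalence of states of the superposed MAP induced by permuting symmetric
  sub-trees, that is, sub-trees with identical MAPs. If all sub-trees are symmetric,
  then the condition on \<open>M\<close> is void and every permutation is admitted; see
  \<open>subtree_equiv_identical\<close>.
\<close>

definition subtree_equiv :: "('n::finite \<Rightarrow> ('s::finite) MAP) \<Rightarrow> ('s ^ 'n) rel" where
  "subtree_equiv M =
     {(A, B). \<exists>f. f permutes UNIV \<and> (\<forall>i. M i = M (f i)) \<and> (\<forall>i. A $ i = B $ f i)}"

definition lumpable_partitions ::
    "('n::finite \<Rightarrow> ('s::finite) MAP) \<Rightarrow> ('s ^ 'n) set set" where
  "lumpable_partitions M = UNIV // subtree_equiv M"

lemma subtree_equiv_identical:
  assumes "\<forall>i j. M i = M j"
  shows "(A, B) \<in> subtree_equiv M \<longleftrightarrow> (\<exists>f. f permutes UNIV \<and> (\<forall>i. A $ i = B $ f i))"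
  using assms unfolding subtree_equiv_def by auto

lemma equiv_subtree_equiv: "equiv UNIV (subtree_equiv M)"
proof (rule equivI)
  show "subtree_equiv M \<subseteq> UNIV \<times> UNIV" by simp
  show "refl (subtree_equiv M)"
    unfolding refl_on_def subtree_equiv_def using permutes_id by fastforce
  show "sym (subtree_equiv M)"
  proof (rule symI)
    fix A B assume "(A, B) \<in> subtree_equiv M"
    then obtain f where f: "f permutes UNIV" "\<And>i. M i = M (f i)" "\<And>i. A $ i = B $ f i"
      unfolding subtree_equiv_def by auto
    then have "M i = M (inv f i)" "B $ i = A $ inv f i" for i
      using permutes_inverses(1)[OF f(1)] by metis+
    then show "(B, A) \<in> subtree_equiv M"
      unfolding subtree_equiv_def using permutes_inv[OF f(1)] by blast
  qed
  show "trans (subtree_equiv M)"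
  proof (rule transI)
    fix A B C assume "(A, B) \<in> subtree_equiv M" "(B, C) \<in> subtree_equiv M"
    then obtain f g where
      "f permutes UNIV" "\<And>i. M i = M (f i)" "\<And>i. A $ i = B $ f i"
      "g permutes UNIV" "\<And>i. M i = M (g i)" "\<And>i. B $ i = C $ g i"
      unfolding subtree_equiv_def by auto
    then have "(g \<circ> f) permutes UNIV \<and> (\<forall>i. M i = M ((g \<circ> f) i)) \<and> (\<forall>i. A $ i = C $ (g \<circ> f) i)"
      using permutes_compose[of f UNIV g] by (metis comp_apply)
    then show "(A, C) \<in> subtree_equiv M"
      unfolding subtree_equiv_def by blast
  qed
qed

lemma kronecker_sum_permute:
  fixes X :: "'n::finite \<Rightarrow> real ^ 's::finite ^ 's"
  assumes f: "f permutes UNIV" and X: "\<And>i. X i = X (f i)"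
  shows "kronecker_sum X $ (\<chi> i. A $ f i) $ (\<chi> i. B $ f i) = kronecker_sum X $ A $ B"
proof -
  have b: "bij f" using f by (rule permutes_bij)
  let ?t = "\<lambda>j k. (if k = j then X k else mat 1) $ (A $ k) $ (B $ k)"
  have "kronecker_sum X $ (\<chi> i. A $ f i) $ (\<chi> i. B $ f i) = (\<Sum>j\<in>UNIV. \<Prod>k\<in>UNIV. ?t (f j) (f k))"
    unfolding kronecker_sum_def using X
    by (auto intro!: sum.cong prod.cong simp: inj_eq[OF bij_is_inj[OF b]])
  also have "\<dots> = (\<Sum>j\<in>UNIV. \<Prod>k\<in>UNIV. ?t (f j) k)"
    by (intro sum.cong refl prod.reindex_bij_betw b)
  also have "\<dots> = (\<Sum>j\<in>UNIV. \<Prod>k\<in>UNIV. ?t j k)"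
    by (rule sum.reindex_bij_betw[OF b])
  finally show ?thesis by (simp add: kronecker_sum_def)
qed

text \<open>The classes of \<open>subtree_equiv\<close> do form a lumping of the superposed MAP.\<close>

lemma lumping_subtree_equiv:
  fixes M :: "'n::finite \<Rightarrow> ('s::finite) MAP"
  shows "lumping (superposition M) (subtree_equiv M)"
proof -
  let ?R = "subtree_equiv M"
  have main: "(\<Sum>c\<in>C. kronecker_sum X $ A $ c) = (\<Sum>c\<in>C. kronecker_sum X $ B $ c)"
    if AB: "(A, B) \<in> ?R" and C: "C \<in> UNIV // ?R" and X: "\<And>i j. M i = M j \<Longrightarrow> X i = X j"
    for A B C and X :: "'n \<Rightarrow> real ^ 's ^ 's"
  proof -
    from AB obtain f where f: "f permutes UNIV" "\<And>i. M i = M (f i)" "\<And>i. A $ i = B $ f i"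
      unfolding subtree_equiv_def by auto
    let ?p = "\<lambda>c. \<chi> i. c $ f i" and ?q = "\<lambda>c. \<chi> i. c $ inv f i"
    have pc: "(?p c, c) \<in> ?R" for c :: "'s ^ 'n"
      unfolding subtree_equiv_def using f by auto
    have inC: "x \<in> C \<longleftrightarrow> y \<in> C" if "(x, y) \<in> ?R" for x y
      using that C equiv_subtree_equiv[of M]
      by (metis in_quotient_imp_closed symD equivE)
    have pq: "?p (?q c) = c" "?q (?p c) = c" for c :: "'s ^ 'n"
      using permutes_inverses[OF f(1)] by (simp_all add: vec_eq_iff)
    have p: "?p c \<in> C \<longleftrightarrow> c \<in> C" for c
      using inC[OF pc] .
    then have q: "?q c \<in> C \<longleftrightarrow> c \<in> C" for c
      using p[of "?q c"] unfolding pq by simp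
    have "bij_betw ?p C C"
      by (rule bij_betw_byWitness[where f' = ?q]) (use pq p q in blast)+
    then have "(\<Sum>c\<in>C. kronecker_sum X $ A $ c) = (\<Sum>c\<in>C. kronecker_sum X $ A $ ?p c)"
      by (rule sum.reindex_bij_betw[symmetric])
    also have "\<dots> = (\<Sum>c\<in>C. kronecker_sum X $ B $ c)"
    proof (rule sum.cong[OF refl])
      fix c
      have "A = ?p B" using f by (simp add: vec_eq_iff)
      then show "kronecker_sum X $ A $ ?p c = kronecker_sum X $ B $ c"
        using kronecker_sum_permute[OF f(1), of X B c] X[OF f(2)] by simp
    qed
    finally show ?thesis .
  qed
  show ?thesis
    unfolding lumping_def superposition_def
    using equiv_subtree_equiv[of M] main by auto
qed

lemma sum_vec_prod:
  fixes g :: "'n::finite \<Rightarrow> 's::finite \<Rightarrow> real"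
  shows "(\<Sum>B\<in>(UNIV :: ('s ^ 'n) set). \<Prod>k\<in>UNIV. g k (B $ k)) = (\<Prod>k\<in>UNIV. \<Sum>b\<in>UNIV. g k b)"
proof -
  have "bij_betw (vec_nth :: 's ^ 'n \<Rightarrow> _) UNIV (PiE UNIV (\<lambda>_. UNIV))"
    by (rule bij_betw_byWitness[where f' = vec_lambda]) auto
  from sum.reindex_bij_betw[OF this, of "\<lambda>h. \<Prod>k\<in>UNIV. g k (h k)"]
  have "(\<Sum>B\<in>(UNIV :: ('s ^ 'n) set). \<Prod>k\<in>UNIV. g k (B $ k))
      = (\<Sum>h\<in>PiE UNIV (\<lambda>_. UNIV). \<Prod>k\<in>UNIV. g k (h k))"
    by simp
  also have "\<dots> = (\<Prod>k\<in>UNIV. \<Sum>b\<in>UNIV. g k b)"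
    by (rule prod_sum_PiE[symmetric]) auto
  finally show ?thesis .
qed

lemma kronecker_sum_row:
  "(\<Sum>B\<in>UNIV. kronecker_sum X $ A $ B) = (\<Sum>j\<in>UNIV. \<Sum>b\<in>UNIV. X j $ (A $ j) $ b)"
proof -
  have "(\<Sum>B\<in>UNIV. kronecker_sum X $ A $ B)
      = (\<Sum>j\<in>UNIV. \<Sum>B\<in>UNIV. \<Prod>k\<in>UNIV. (if k = j then X k else mat 1) $ (A $ k) $ (B $ k))"
    unfolding kronecker_sum_def by (simp, rule sum.swap)
  also have "\<dots> = (\<Sum>j\<in>UNIV. \<Prod>k\<in>UNIV. \<Sum>b\<in>UNIV. (if k = j then X k else mat 1) $ (A $ k) $ b)"
    by (intro sum.cong refl sum_vec_prod)
  also have "\<dots> = (\<Sum>j\<in>UNIV. \<Prod>k\<in>UNIV. if k = j then \<Sum>b\<in>UNIV. X j $ (A $ j) $ b else 1)"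
    by (intro sum.cong prod.cong refl) (auto simp: mat_def)
  finally show ?thesis by simp
qed

lemma is_MAP_superposition:
  fixes M :: "'n::finite \<Rightarrow> ('s::finite) MAP"
  assumes "\<forall>j. is_MAP (M j)"
  shows "is_MAP (superposition M)"
  unfolding is_MAP_def
proof (intro conjI allI impI)
  fix A B :: "'s ^ 'n"
  show "0 \<le> D1 (superposition M) $ A $ B"
    using assms unfolding superposition_def kronecker_sum_def is_MAP_def
    by (auto intro!: sum_nonneg prod_nonneg simp: mat_def)
  assume "A \<noteq> B"
  have "0 \<le> (\<Prod>k\<in>UNIV. (if k = j then D0 (M k) else mat 1) $ (A $ k) $ (B $ k))" for j
  proof (cases "\<exists>k. k \<noteq> j \<and> A $ k \<noteq> B $ k")
    case True
    then obtain i where "i \<noteq> j" "A $ i \<noteq> B $ i" by blast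
    then have "(\<Prod>k\<in>UNIV. (if k = j then D0 (M k) else mat 1) $ (A $ k) $ (B $ k)) = 0"
      by (intro prod_zero bexI[of _ i]) (simp_all add: mat_def)
    then show ?thesis by (simp only: order_refl)
  next
    case False
    with \<open>A \<noteq> B\<close> have "A $ j \<noteq> B $ j" by (metis vec_eq_iff)
    with assms show ?thesis
      unfolding is_MAP_def by (intro prod_nonneg) (auto simp: mat_def)
  qed
  then show "0 \<le> D0 (superposition M) $ A $ B"
    unfolding superposition_def kronecker_sum_def by (auto intro!: sum_nonneg)
next
  fix A :: "'s ^ 'n"
  have "(\<Sum>B\<in>UNIV. (D0 (superposition M) + D1 (superposition M)) $ A $ B)
      = (\<Sum>j\<in>UNIV. \<Sum>b\<in>UNIV. (D0 (M j) + D1 (M j)) $ (A $ j) $ b)"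
    by (simp add: superposition_def sum.distrib kronecker_sum_row)
  also have "\<dots> = 0"
    using assms unfolding is_MAP_def by simp
  finally show "(\<Sum>B\<in>UNIV. (D0 (superposition M) + D1 (superposition M)) $ A $ B) = 0" .
qed

end

theory Submission
  imports Defs
begin

text \<open>
  Two tuples are related by a permutation of positions iff they have the same multiset of entries,
  so the classes correspond to the multisets of size \<open>n\<close> over the state set. The inequality holds
  because there are at most as many classes as tuples.
\<close>

definition entries :: "'s ^ 'n::finite \<Rightarrow> 's multiset" where
  "entries A = image_mset (vec_nth A) (mset_set UNIV)"

text \<open>A multiset records how often each state occurs but not in which sub-tree, and this is
  exactly what permutations of positions preserve.\<close>

lemma entries_eq_iff_permutes:
  fixes A B :: "'s ^ 'n::finite"
  shows "entries A = entries B \<longleftrightarrow> (\<exists>f. f permutes UNIV \<and> (\<forall>i. A $ i = B $ f i))"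
proof
  assume "entries A = entries B"
  then show "\<exists>f. f permutes UNIV \<and> (\<forall>i. A $ i = B $ f i)"
    unfolding entries_def by (elim image_mset_eq_implies_permutes[rotated]) auto
next
  assume "\<exists>f. f permutes UNIV \<and> (\<forall>i. A $ i = B $ f i)"
  then obtain f where "f permutes UNIV" "\<And>i. A $ i = B $ f i"
    by blast
  then show "entries A = entries B"
    unfolding entries_def by (intro permutes_implies_image_mset_eq[symmetric])
qed

lemma range_entries:
  "range (entries :: 's ^ 'n::finite \<Rightarrow> _) = multisets_of_size UNIV CARD('n)"
proof (intro equalityI subsetI)
  fix X :: "'s multiset"
  assume X: "X \<in> multisets_of_size UNIV CARD('n)"
  obtain xs where xs: "mset xs = X"
    using ex_mset by blast
  with X have len: "length xs = CARD('n)"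
    by (auto simp: multisets_of_size_def)
  \<comment> \<open>The index type has no order of its own; \<open>h\<close> numbers it so that the
    list \<open>xs\<close> can be read off as a tuple.\<close>
  obtain h :: "'n \<Rightarrow> nat" where h: "bij_betw h UNIV {0..<CARD('n)}"
    using ex_bij_betw_finite_nat[OF finite, of "UNIV :: 'n set"] by blast
  have "entries (\<chi> i. xs ! h i) = image_mset ((!) xs) (image_mset h (mset_set UNIV))"
    by (simp add: entries_def multiset.map_comp comp_def vec_lambda_inverse)
  also have "image_mset h (mset_set UNIV) = mset_set {0..<length xs}"
    using h len by (simp add: image_mset_mset_set bij_betw_def)
  also have "image_mset ((!) xs) \<dots> = mset xs"
    by (metis map_nth mset_map mset_upt)
  finally show "X \<in> range (entries :: 's ^ 'n \<Rightarrow> _)"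
    using xs by (metis rangeI)
qed (auto simp: entries_def multisets_of_size_def)

text \<open>As a kernel, the relation has classes that are the fibres of \<open>entries\<close>, so
  they biject with its range.\<close>

lemma subtree_equiv_eq_kernel:
  assumes "\<forall>i j. M i = M j"
  shows "subtree_equiv M = kernel entries"
  using subtree_equiv_identical[OF assms]
  by (auto simp: kernel_def entries_eq_iff_permutes)

theorem theorem1:
  fixes M :: "'n::finite \<Rightarrow> ('s::finite) MAP"
  assumes "\<forall>j. is_MAP (M j)"
    and "\<forall>j. refined (M j)"
    and "\<forall>i j. M i = M j"
    and "CARD('s) \<ge> 3"
  shows "card (lumpable_partitions M) = (CARD('n) + CARD('s) - 1) choose (CARD('s) - 1) \<and>
    (CARD('n) + CARD('s) - 1) choose (CARD('s) - 1) \<le> CARD('s) ^ CARD('n)"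
proof -
  have "card (lumpable_partitions M) = card (range (entries :: 's ^ 'n \<Rightarrow> _))"
    unfolding lumpable_partitions_def subtree_equiv_eq_kernel[OF assms(3)]
    by (rule bij_betw_same_card[OF bij_betw_image_quotient_kernel, symmetric])
  \<comment> \<open>Stars and bars.\<close>
  also have "\<dots> = (CARD('n) + CARD('s) - 1) choose CARD('n)"
    by (simp add: range_entries card_multisets_of_size add.commute)
  \<comment> \<open>Since \<open>CARD('s)\<close> is positive, the lower index does not exceed the
    upper one and the truncated subtractions are exact.\<close>
  also have "\<dots> = (CARD('n) + CARD('s) - 1) choose (CARD('s) - 1)"
    using binomial_symmetric[of "CARD('n)" "CARD('n) + CARD('s) - 1"] assms(4) by simp
  finally have eq: "card (lumpable_partitions M) = \<dots>" .
  have "card (lumpable_partitions M) \<le> CARD('s ^ 'n)"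
    \<comment> \<open>This exhibits the quotient as the image of the set of tuples under the map to
      classes.\<close>
    unfolding lumpable_partitions_def quotient_def UNION_singleton_eq_range
    by (intro card_image_le finite)
  then show ?thesis
    using eq by (simp add: CARD_vec)
qed

end
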